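(* Let $X$ be a Banach space (not necessarily reflexive), let $u_0\in X$, and let $F:X\to X$ be a twice Fréchet differentiable map such that for every $R>0$ there are finite constants $M_1(R),M_2(R)$ with $$\sup_{u\in B(u_0,R)}\|F^{(j)}(u)\|\le M_j(R),\qquad j=1,2.$$ Assume that there are constants $c_0>0$, $k>0$ and $\varepsilon_0>0$ such that for every $u\in X$ and every $\varepsilon\in(0,\varepsilon_0)$ the operator $F'(u)+\varepsilon I$ is boundedly invertible and $$\|(F'(u)+\varepsilon I)^{-1}\|\le c_0\,\varepsilon^{-k}.$$ Then for every $\varepsilon\in(0,\varepsilon_0)$ the equation $$F(u)+\varepsilon u=0$$ has a solution $u\in X$.
   Context: $B(u_0,R):=\{u\in X:\|u-u_0\|\le R\}$. $F^{(j)}(u)$ is the $j$-th Fréchet derivative of $F$ at $u$, with $F'=F^{(1)}$, and its norm is the usual norm of bounded ($j$-linear) operators. $I$ is the identity operator on $X$. *)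

theory Defs
  imports "HOL-Analysis.Analysis"
begin

definition boundedly_invertible ::
    "('a::real_normed_vector \<Rightarrow>\<^sub>L 'b::real_normed_vector) \<Rightarrow> bool" where
  "boundedly_invertible A \<longleftrightarrow>
     (\<exists>B. B o\<^sub>L A = id_blinfun \<and> A o\<^sub>L B = id_blinfun)"

text \<open>Only meaningful for boundedly invertible operators.\<close>

definition blinfun_inverse ::
    "('a::real_normed_vector \<Rightarrow>\<^sub>L 'b::real_normed_vector) \<Rightarrow> ('b \<Rightarrow>\<^sub>L 'a)" where
  "blinfun_inverse A = (THE B. B o\<^sub>L A = id_blinfun \<and> A o\<^sub>L B = id_blinfun)"

lemma blinfun_inverse_eqI:
  assumes "B o\<^sub>L A = id_blinfun" and "A o\<^sub>L B = id_blinfun"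
  shows "blinfun_inverse A = B"
  unfolding blinfun_inverse_def
proof (rule the_equality)
  show "B o\<^sub>L A = id_blinfun \<and> A o\<^sub>L B = id_blinfun"
    using assms by simp
next
  fix C assume C: "C o\<^sub>L A = id_blinfun \<and> A o\<^sub>L C = id_blinfun"
  show "C = B"
  proof (rule blinfun_eqI)
    fix x
    have "blinfun_apply C x = blinfun_apply (C o\<^sub>L (A o\<^sub>L B)) x"
      using assms by simp
    also have "\<dots> = blinfun_apply (C o\<^sub>L A) (blinfun_apply B x)"
      by simp
    also have "\<dots> = blinfun_apply B x"
      using C by (simp del: blinfun_apply_blinfun_compose)
    finally show "blinfun_apply C x = blinfun_apply B x" .
  qed
qed

lemma blinfun_inverse_compose:
  assumes "boundedly_invertible A"
  shows "blinfun_inverse A o\<^sub>L A = id_blinfun" and "A o\<^sub>L blinfun_inverse A = id_blinfun"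
  using assms blinfun_inverse_eqI unfolding boundedly_invertible_def by blast+

end

(* Put G u = F u + \<epsilon> u. The damped Newton iteration u \<mapsto> u - h G'(u)^{-1} G(u), with the
   step size h fixed and small, contracts the residual norm (G u) by the factor 1 - h/2 as long as it stays
   in a ball on which G' is Lipschitz: the linear part contributes 1 - h and the Taylor
   remainder is quadratic in h. The increments are then bounded by a geometric series whose
   sum is at most 2 m norm (G u0), where m bounds the inverses, so the iteration never leaves
   the ball of that radius around u0 and converges to a zero of G. *)

theory Submission
  imports Defs
begin

text \<open>Since \<open>G' x\<close> maps \<open>v\<close> to \<open>G x\<close>, the linearization
  of \<open>G\<close> at \<open>x\<close> takes the value \<open>(1 - h) *\<^sub>R G x\<close> at
  \<open>x - h *\<^sub>R v\<close>. The Lipschitz bound on \<open>G'\<close> limits the error to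
  \<open>L\<close> times the squared step length, and the step length is at most
  \<open>h * m * norm (G x)\<close>.\<close>

lemma damped_newton_step:
  fixes G :: "'a::real_normed_vector \<Rightarrow> 'b::real_normed_vector"
    and G' :: "'a \<Rightarrow> 'a \<Rightarrow>\<^sub>L 'b"
  assumes S: "convex S"
    and der: "\<And>x. x \<in> S \<Longrightarrow> (G has_derivative blinfun_apply (G' x)) (at x within S)"
    and lip: "\<And>x y. x \<in> S \<Longrightarrow> y \<in> S \<Longrightarrow> norm (G' x - G' y) \<le> L * norm (x - y)"
    and L: "0 \<le> L"
    and xv: "x \<in> S" "x - h *\<^sub>R v \<in> S" and h: "0 \<le> h" "h \<le> 1"
    and v: "blinfun_apply (G' x) v = G x" "norm v \<le> m * norm (G x)"
  shows "norm (G (x - h *\<^sub>R v)) \<le> (1 - h + L * m\<^sup>2 * h\<^sup>2 * norm (G x)) * norm (G x)"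
proof -
  define y where "y = x - h *\<^sub>R v"
  have seg: "x + t *\<^sub>R (y - x) \<in> S" if "t \<in> {0..1}" for t
    using convexD_alt[OF S xv(1), of y t] that xv(2) by (simp add: y_def algebra_simps)
  \<comment> \<open>The linearization bound is applied on the segment \<open>T\<close> rather than
    on \<open>S\<close>: only there is \<open>G' z - G' x\<close> bounded by
    \<open>L * norm (y - x)\<close>.\<close>
  define T where "T = (\<lambda>t. x + t *\<^sub>R (y - x)) ` {0..1}"
  have TS: "T \<subseteq> S" using seg by (auto simp: T_def)
  have "norm (G y - G x - blinfun_apply (G' x) (y - x)) \<le> norm (y - x) * (L * norm (y - x))"
  proof (rule differentiable_bound_linearization[where S = T and f' = "\<lambda>x. blinfun_apply (G' x)"])
    show "x + t *\<^sub>R (y - x) \<in> T" if "t \<in> {0..1}" for t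
      using that by (auto simp: T_def)
    show "(G has_derivative blinfun_apply (G' z)) (at z within T)" if "z \<in> T" for z
      using der[of z] that TS has_derivative_subset by blast
    show "onorm (blinfun_apply (G' z) - blinfun_apply (G' x)) \<le> L * norm (y - x)" if z: "z \<in> T" for z
    proof -
      obtain t where t: "0 \<le> t" "t \<le> 1" "z = x + t *\<^sub>R (y - x)"
        using z by (auto simp: T_def)
      have "norm (G' z - G' x) \<le> L * norm (z - x)"
        using lip z xv(1) TS by blast
      also have "\<dots> \<le> L * norm (y - x)"
        using t L by (intro mult_left_mono) (auto simp: mult_left_le_one_le)
      finally show ?thesis
        by (simp add: norm_blinfun.rep_eq minus_blinfun.rep_eq fun_diff_def)
    qed
    show "x \<in> T" unfolding T_def by (rule image_eqI[of _ _ 0]) auto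
  qed
  also have "norm (y - x) = h * norm v"
    using h by (simp add: y_def)
  also have "h * norm v * (L * (h * norm v)) = L * h\<^sup>2 * (norm v)\<^sup>2"
    by (simp add: power2_eq_square)
  also have "\<dots> \<le> L * h\<^sup>2 * (m * norm (G x))\<^sup>2"
    using v(2) L by (intro mult_left_mono power_mono) auto
  finally have R: "norm (G y - (1 - h) *\<^sub>R G x) \<le> L * h\<^sup>2 * (m * norm (G x))\<^sup>2"
    using v(1) by (simp add: y_def blinfun.bilinear_simps algebra_simps)
  have "norm (G y) \<le> norm (G y - (1 - h) *\<^sub>R G x) + norm ((1 - h) *\<^sub>R G x)"
    using norm_triangle_sub[of "G y" "(1 - h) *\<^sub>R G x"] by simp
  also have "\<dots> \<le> L * h\<^sup>2 * (m * norm (G x))\<^sup>2 + (1 - h) * norm (G x)"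
    using R h by simp
  finally show ?thesis
    by (simp add: y_def algebra_simps power2_eq_square)
qed

text \<open>The Lipschitz constant \<open>L\<close> affects only the step size, not the radius
  condition. So the ball can be fixed first and \<open>L\<close> read off from it afterwards,
  without circularity.\<close>

lemma damped_newton_zero:
  fixes G :: "'a::banach \<Rightarrow> 'b::real_normed_vector"
    and G' :: "'a \<Rightarrow> 'a \<Rightarrow>\<^sub>L 'b" and B :: "'a \<Rightarrow> 'b \<Rightarrow>\<^sub>L 'a" and u0 :: 'a and R :: real
  defines "S \<equiv> cball u0 R"
  assumes der: "\<And>x. x \<in> S \<Longrightarrow> (G has_derivative blinfun_apply (G' x)) (at x within S)"
    and lip: "\<And>x y. x \<in> S \<Longrightarrow> y \<in> S \<Longrightarrow> norm (G' x - G' y) \<le> L * norm (x - y)"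
    and L: "0 \<le> L"
    and right_inverse: "\<And>x. x \<in> S \<Longrightarrow> G' x o\<^sub>L B x = id_blinfun"
    and m: "0 \<le> m" "\<And>x. x \<in> S \<Longrightarrow> norm (B x) \<le> m"
    and R: "2 * m * norm (G u0) \<le> R"
  shows "\<exists>u \<in> S. G u = 0"
proof -
  define g where "g = norm (G u0)"
  define A where "A = L * m\<^sup>2 * g"
  \<comment> \<open>This choice gives \<open>A * h \<le> 1 / 2\<close>, so the quadratic term
    \<open>A * h\<^sup>2\<close> uses up at most half of the gain \<open>h\<close>, and the
    contraction factor is at most \<open>q\<close>.\<close>
  define h where "h = 1 / (2 + 2 * A)"
  define q where "q = 1 - h / 2"
  have g: "0 \<le> g" and A: "0 \<le> A" using L by (auto simp: g_def A_def)
  have h: "0 < h" "h \<le> 1" "A * h \<le> 1 / 2"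
    using A by (auto simp: h_def field_simps)
  have q: "0 < q" "q < 1" using h by (auto simp: q_def)
  define v where "v x = blinfun_apply (B x) (G x)" for x
  have v: "blinfun_apply (G' x) (v x) = G x" "norm (v x) \<le> m * norm (G x)" if "x \<in> S" for x
  proof -
    show "blinfun_apply (G' x) (v x) = G x"
      using arg_cong[OF right_inverse[OF that], of "\<lambda>T. blinfun_apply T (G x)"]
      by (simp add: v_def)
    show "norm (v x) \<le> m * norm (G x)"
      unfolding v_def using norm_blinfun m(2)[OF that]
      by (meson mult_right_mono norm_ge_zero order_trans)
  qed
  define u where "u n = ((\<lambda>x. x - h *\<^sub>R v x) ^^ n) u0" for n
  have u_0: "u 0 = u0" and u_Suc: "u (Suc n) = u n - h *\<^sub>R v (u n)" for n
    by (simp_all add: u_def)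
  have in_S: "x \<in> S" if "norm (x - u0) \<le> 2 * m * g * (1 - q ^ n)" for x n
  proof -
    have "2 * m * g * (1 - q ^ n) \<le> 2 * m * g * 1"
      using q m g by (intro mult_left_mono) auto
    then show ?thesis
      using that R by (simp add: S_def g_def dist_norm norm_minus_commute)
  qed
  \<comment> \<open>As \<open>1 - q = h / 2\<close>, the bound \<open>h * m * q ^ n * g\<close> is a
    difference of consecutive powers, so that the step bounds telescope.\<close>
  have step: "norm (h *\<^sub>R v x) \<le> 2 * m * g * (q ^ n - q ^ Suc n)"
    if "x \<in> S" "norm (G x) \<le> q ^ n * g" for x n
  proof -
    have "norm (h *\<^sub>R v x) \<le> h * (m * (q ^ n * g))"
      using v(2)[OF that(1)] that(2) h m(1)
      by (auto intro!: mult_left_mono order_trans[OF v(2)[OF that(1)]])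
    also have "\<dots> = 2 * m * g * (q ^ n - q ^ Suc n)"
      by (simp add: q_def algebra_simps)
    finally show ?thesis .
  qed
  \<comment> \<open>The two bounds need each other: the residual bound controls the next step, and
    the distance bound keeps the iterates in \<open>S\<close>. The distance comes first in the
    induction step, because the one-step estimate requires the new point to lie in
    \<open>S\<close>.\<close>
  have inv: "norm (G (u n)) \<le> q ^ n * g \<and> norm (u n - u0) \<le> 2 * m * g * (1 - q ^ n)" for n
  proof (induction n)
    case 0
    then show ?case by (simp add: u_0 g_def)
  next
    case (Suc n)
    then have n: "norm (G (u n)) \<le> q ^ n * g" "norm (u n - u0) \<le> 2 * m * g * (1 - q ^ n)" by auto
    have unS: "u n \<in> S" using in_S n(2) .
    have "norm (u (Suc n) - u0) \<le> norm (u n - u0) + norm (h *\<^sub>R v (u n))"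
      using norm_triangle_ineq4[of "u n - u0" "h *\<^sub>R v (u n)"] by (simp add: u_Suc algebra_simps)
    also have "\<dots> \<le> 2 * m * g * (1 - q ^ n) + 2 * m * g * (q ^ n - q ^ Suc n)"
      using n(2) step[OF unS n(1)] by (rule add_mono)
    also have "\<dots> = 2 * m * g * (1 - q ^ Suc n)"
      by (simp add: algebra_simps)
    finally have 1: "norm (u (Suc n) - u0) \<le> 2 * m * g * (1 - q ^ Suc n)" .
    have "norm (G (u (Suc n))) \<le> (1 - h + L * m\<^sup>2 * h\<^sup>2 * norm (G (u n))) * norm (G (u n))"
      unfolding u_Suc
      using in_S[OF 1] h unS v[OF unS] der lip L
      by (intro damped_newton_step[where S = "S" and G' = G']) (auto simp: S_def u_Suc)
    also have "\<dots> \<le> q * norm (G (u n))"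
    proof (rule mult_right_mono)
      \<comment> \<open>Residuals never exceed the initial one, so the step size fixed through
        \<open>g\<close> works for every \<open>n\<close>.\<close>
      have "norm (G (u n)) \<le> g"
        using n(1) q g by (meson mult_left_le_one_le order_trans power_le_one less_imp_le zero_le_power)
      then have "L * m\<^sup>2 * h\<^sup>2 * norm (G (u n)) \<le> L * m\<^sup>2 * h\<^sup>2 * g"
        using L by (intro mult_left_mono) auto
      also have "\<dots> = h * (A * h)" by (simp add: A_def power2_eq_square)
      also have "\<dots> \<le> h * (1 / 2)" using h by (intro mult_left_mono) auto
      finally show "1 - h + L * m\<^sup>2 * h\<^sup>2 * norm (G (u n)) \<le> q"
        by (simp add: q_def)
    qed simp
    also have "\<dots> \<le> q * (q ^ n * g)"
      using n(1) q by (intro mult_left_mono) auto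
    finally show ?case using 1 by (simp add: mult.assoc)
  qed
  then have uS: "u n \<in> S" for n using in_S by blast
  \<comment> \<open>Completeness enters here: the increments are dominated by a geometric series,
    and their partial sums are \<open>u n - u 0\<close>, so \<open>u\<close> converges.\<close>
  have "summable (\<lambda>n. u (Suc n) - u n)"
  proof (rule summable_comparison_test'[where N = 0])
    show "summable (\<lambda>n. 2 * m * g * (1 - q) * q ^ n)"
      using q by (intro summable_mult summable_geometric) auto
    show "norm (u (Suc n) - u n) \<le> 2 * m * g * (1 - q) * q ^ n" for n
      using step[OF uS, of n n] inv[of n] by (simp add: u_Suc algebra_simps)
  qed
  then have "(\<lambda>n. u n - u 0) \<longlonglongrightarrow> (\<Sum>n. u (Suc n) - u n)"
    using summable_LIMSEQ sum_lessThan_telescope[of u] by fastforce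
  then have "(\<lambda>n. u n - u 0 + u 0) \<longlonglongrightarrow> (\<Sum>n. u (Suc n) - u n) + u 0"
    by (intro tendsto_add tendsto_const)
  then obtain w where w: "u \<longlonglongrightarrow> w" by auto
  have wS: "w \<in> S"
    using closed_sequentially[OF _ _ w, of "S"] uS by (auto simp: S_def)
  have "continuous_on (S) G" using der by (rule has_derivative_continuous_on)
  then have "(\<lambda>n. G (u n)) \<longlonglongrightarrow> G w"
    using wS uS w by (auto intro: continuous_on_tendsto_compose)
  moreover have "(\<lambda>n. G (u n)) \<longlonglongrightarrow> 0"
  proof (rule Lim_null_comparison)
    show "\<forall>\<^sub>F n in sequentially. norm (G (u n)) \<le> q ^ n * g" using inv by simp
    show "(\<lambda>n. q ^ n * g) \<longlonglongrightarrow> 0"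
      using q by (intro tendsto_mult_left_zero LIMSEQ_power_zero) auto
  qed
  ultimately show ?thesis using wS LIMSEQ_unique by blast
qed

theorem theorem1:
  fixes F :: "'a::banach \<Rightarrow> 'a"
    and F' :: "'a \<Rightarrow> 'a \<Rightarrow>\<^sub>L 'a"
    and F'' :: "'a \<Rightarrow> 'a \<Rightarrow>\<^sub>L 'a \<Rightarrow>\<^sub>L 'a"
    and u0 :: 'a
    and M1 M2 :: "real \<Rightarrow> real"
    and c0 k \<epsilon>0 :: real
  assumes "\<And>u. (F has_derivative blinfun_apply (F' u)) (at u)"
    and "\<And>u. (F' has_derivative blinfun_apply (F'' u)) (at u)"
    and "\<And>R u. R > 0 \<Longrightarrow> u \<in> cball u0 R \<Longrightarrow> norm (F' u) \<le> M1 R"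
    and "\<And>R u. R > 0 \<Longrightarrow> u \<in> cball u0 R \<Longrightarrow> norm (F'' u) \<le> M2 R"
    and "c0 > 0" and "k > 0" and "\<epsilon>0 > 0"
    and "\<And>u \<epsilon>. \<epsilon> \<in> {0<..<\<epsilon>0} \<Longrightarrow> boundedly_invertible (F' u + \<epsilon> *\<^sub>R id_blinfun)"
    and "\<And>u \<epsilon>. \<epsilon> \<in> {0<..<\<epsilon>0} \<Longrightarrow>
           norm (blinfun_inverse (F' u + \<epsilon> *\<^sub>R id_blinfun)) \<le> c0 * \<epsilon> powr (- k)"
  shows "\<forall>\<epsilon>\<in>{0<..<\<epsilon>0}. \<exists>u. F u + \<epsilon> *\<^sub>R u = 0"
proof
  fix \<epsilon> assume \<epsilon>: "\<epsilon> \<in> {0<..<\<epsilon>0}"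
  define G where "G u = F u + \<epsilon> *\<^sub>R u" for u
  define G' where "G' u = F' u + \<epsilon> *\<^sub>R id_blinfun" for u
  define m where "m = c0 * \<epsilon> powr (- k)"
  \<comment> \<open>The summand 1 keeps the radius positive even if \<open>m * norm (G u0)\<close>
    is 0, since the derivative bounds are given for positive radii.\<close>
  define R where "R = 2 * m * norm (G u0) + 1"
  have m: "0 \<le> m" using assms(5) by (simp add: m_def)
  then have R: "0 < R" by (simp add: R_def add_nonneg_pos)
  have M2: "0 \<le> M2 R"
    using order_trans[OF norm_ge_zero assms(4)[of R u0]] R by simp
  have "\<exists>u \<in> cball u0 R. G u = 0"
  proof (rule damped_newton_zero[where G' = G' and L = "M2 R" and m = m
        and B = "\<lambda>u. blinfun_inverse (G' u)"])
    fix x assume "x \<in> cball u0 R"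
    have "blinfun_apply (G' x) = (\<lambda>h. blinfun_apply (F' x) h + \<epsilon> *\<^sub>R h)"
      by (auto simp: G'_def blinfun.bilinear_simps)
    then show "(G has_derivative blinfun_apply (G' x)) (at x within cball u0 R)"
      unfolding G_def using has_derivative_at_withinI[OF assms(1)]
      by (auto intro!: derivative_intros)
    show "G' x o\<^sub>L blinfun_inverse (G' x) = id_blinfun"
      unfolding G'_def by (rule blinfun_inverse_compose(2)[OF assms(8)[OF \<epsilon>]])
    show "norm (blinfun_inverse (G' x)) \<le> m"
      unfolding G'_def m_def by (rule assms(9)[OF \<epsilon>])
  next
    fix x y assume xy: "x \<in> cball u0 R" "y \<in> cball u0 R"
    \<comment> \<open>The mean value inequality on the convex ball turns the bound on
      \<open>F''\<close> into a Lipschitz bound for \<open>F'\<close>; the multiple of the identity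
      cancels in differences of \<open>G'\<close>.\<close>
    have "norm (F' x - F' y) \<le> M2 R * norm (x - y)"
      using assms(4)[OF R] has_derivative_at_withinI[OF assms(2)] xy
      by (intro differentiable_bound[OF convex_cball]) (auto simp: norm_blinfun.rep_eq)
    then show "norm (G' x - G' y) \<le> M2 R * norm (x - y)"
      by (simp add: G'_def)
  qed (use m M2 in \<open>auto simp: R_def\<close>)
  then show "\<exists>u. F u + \<epsilon> *\<^sub>R u = 0"
    by (auto simp: G_def)
qed

end
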